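(* Fix an integer $t\ge1$, let $\beta^\star\in(1/2,1]$ and $T^\star>0$. For each $K$ put $\delta^\star=\sqrt{2(1/T^\star)\ln K}$, $\varepsilon^\star=K^{-\beta^\star}$, let $\mathbf{E}^\star$ denote expectation under $\mathbf{P}_{\varepsilon^\star,\delta^\star}$, and let $(E_s)_{s\ge1}$ be a test martingale (for the model with $K$ streams). Let $t^\star=T^\star\rho(\beta^\star)$. Then $$\mathbf{E}^\star[\ln E_t]\to 0\quad\text{as }K\to\infty\quad\text{if } t<t^\star.$$
   Context: Model: for $K\in\mathbf{N}$, $\varepsilon\in[0,1]$, $\delta>0$, $\mathbf{P}_{\varepsilon,\delta}$ is the law of an array $(X_{i,s})_{1\le i\le K,\,s\ge1}$ generated as follows: $A_1,\dots,A_K$ are i.i.d. Bernoulli$(\varepsilon)$ (latent), and conditionally on $(A_i)$ the $X_{i,s}$ are independent with $X_{i,s}\sim\mathrm{Normal}(\delta A_i,1)$. $\mathbf{P}_0$ is the law under which all $X_{i,s}$ are i.i.d. Normal$(0,1)$ (that is, $\varepsilon=0$). The testing problem is $\mathcal{H}_0:\varepsilon=0$ against $\mathcal{H}_1:\varepsilon>0$ and $\delta>0$. Filtration: $\mathcal{F}_s=\sigma(X_{i,u}:u\le s,\ 1\le i\le K)$, $s\ge1$. A test martingale is an $(\mathcal{F}_s)$-adapted $\mathbf{P}_0$-martingale $(E_s)_{s\ge1}$ that is nonnegative and starts at one, that is, $E_1=1$. Detection boundary: $\rho(\beta)=\beta-\frac12$ for $\beta\in(1/2,3/4)$ and $\rho(\beta)=(1-\sqrt{1-\beta})^2$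 for $\beta\in[3/4,1]$.
   Formalization: Convergence to 0 fails for some test martingales (E_1=1, E_s=2·1{X_{1,2}>0} for s≥2), so what is proved is: limsup E*[ln E_t] ≤ 0 for any test martingales, convergence to 0 when liminf E*[ln E_t] ≥ 0, and the supremum of E*[ln E_t] over all test martingales tends to 0. *)

theory Defs
  imports "HOL-Probability.Probability"
begin

text \<open>An array \<open>x :: nat \<times> nat \<Rightarrow> real\<close> has the observation \<open>X\<^sub>i\<^sub>,\<^sub>s\<close> of stream \<open>i\<close> at time
  \<open>s\<close> as its entry \<open>x (i, s)\<close>. All laws live on the canonical product space of such arrays.\<close>

definition array_index :: "nat \<Rightarrow> (nat \<times> nat) set" where
  "array_index K = {1..K} \<times> {1..}"

definition normal_measure :: "real \<Rightarrow> real measure" where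
  "normal_measure \<mu> = density lborel (normal_density \<mu> 1)"

text \<open>Conditional law of the array given the latent indicators \<open>A\<close>.\<close>

definition cond_law :: "nat \<Rightarrow> real \<Rightarrow> (nat \<Rightarrow> bool) \<Rightarrow> (nat \<times> nat \<Rightarrow> real) measure" where
  "cond_law K \<delta> A = PiM (array_index K) (\<lambda>(i, s). normal_measure (\<delta> * of_bool (A i)))"

text \<open>The indicators outside \<open>{1..K}\<close> are set to \<open>False\<close>; they play no role.\<close>

definition array_law :: "nat \<Rightarrow> real \<Rightarrow> real \<Rightarrow> (nat \<times> nat \<Rightarrow> real) measure" where
  "array_law K \<epsilon> \<delta> =
     bind (measure_pmf (Pi_pmf {1..K} False (\<lambda>_. bernoulli_pmf \<epsilon>))) (cond_law K \<delta>)"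

definition null_law :: "nat \<Rightarrow> (nat \<times> nat \<Rightarrow> real) measure" where
  "null_law K = PiM (array_index K) (\<lambda>_. normal_measure 0)"

definition obs_filtration :: "nat \<Rightarrow> nat \<Rightarrow> (nat \<times> nat \<Rightarrow> real) measure" where
  "obs_filtration K s = sigma (space (null_law K))
     {(\<lambda>x. x (i, u)) -` B \<inter> space (null_law K) | i u B.
        i \<in> {1..K} \<and> u \<in> {1..s} \<and> B \<in> sets borel}"

text \<open>Time runs over \<open>s \<ge> 1\<close>; the value at index \<open>0\<close> is unconstrained. Nonnegativity and
  the initial value are only required almost surely under the null law.\<close>

definition test_martingale :: "nat \<Rightarrow> (nat \<Rightarrow> (nat \<times> nat \<Rightarrow> real) \<Rightarrow> real) \<Rightarrow> bool" where
  "test_martingale K E \<longleftrightarrow>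
     (\<forall>s\<ge>1. E s \<in> borel_measurable (obs_filtration K s)) \<and>
     (\<forall>s\<ge>1. integrable (null_law K) (E s)) \<and>
     (\<forall>u\<ge>1. \<forall>s\<ge>u. AE x in null_law K.
        real_cond_exp (null_law K) (obs_filtration K u) (E s) x = E u x) \<and>
     (\<forall>s\<ge>1. AE x in null_law K. 0 \<le> E s x) \<and>
     (AE x in null_law K. E 1 x = 1)"

text \<open>A test martingale may vanish, so the logarithm and its expectation take values in the
  extended reals, with \<open>ln 0 = -\<infinity>\<close>. If the positive and the negative part of the integrand
  both have infinite integral, the convention of \<open>ereal\<close> makes the expectation \<open>\<infinity>\<close>.\<close>

definition ext_ln :: "real \<Rightarrow> ereal" where
  "ext_ln x = (if x \<le> 0 then -\<infinity> else ereal (ln x))"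

definition ext_expectation :: "'a measure \<Rightarrow> ('a \<Rightarrow> ereal) \<Rightarrow> ereal" where
  "ext_expectation M f =
     enn2ereal (\<integral>\<^sup>+ x. e2ennreal (max 0 (f x)) \<partial>M) -
     enn2ereal (\<integral>\<^sup>+ x. e2ennreal (max 0 (- f x)) \<partial>M)"

definition detection_boundary :: "real \<Rightarrow> real" where
  "detection_boundary \<beta> = (if \<beta> < 3 / 4 then \<beta> - 1 / 2 else (1 - sqrt (1 - \<beta>))\<^sup>2)"

definition alt_law :: "real \<Rightarrow> real \<Rightarrow> nat \<Rightarrow> (nat \<times> nat \<Rightarrow> real) measure" where
  "alt_law \<beta> T K = array_law K (real K powr (- \<beta>)) (sqrt (2 * (1 / T) * ln (real K)))"

definition expected_log ::
    "real \<Rightarrow> real \<Rightarrow> nat \<Rightarrow> (nat \<Rightarrow> (nat \<times> nat \<Rightarrow> real) \<Rightarrow> real) \<Rightarrow> nat \<Rightarrow> ereal" where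
  "expected_log \<beta> T K E t = ext_expectation (alt_law \<beta> T K) (\<lambda>x. ext_ln (E t x))"

lemma prob_space_normal_measure: "prob_space (normal_measure \<mu>)"
  unfolding normal_measure_def by (rule prob_space_normal_density) simp

lemma sets_normal_measure [simp, measurable_cong]: "sets (normal_measure \<mu>) = sets borel"
  by (simp add: normal_measure_def)

lemma space_normal_measure [simp]: "space (normal_measure \<mu>) = UNIV"
  by (simp add: normal_measure_def)

lemma prob_space_null_law: "prob_space (null_law K)"
  unfolding null_law_def by (rule prob_space_PiM) (rule prob_space_normal_measure)

lemma prob_space_cond_law: "prob_space (cond_law K \<delta> A)"
  unfolding cond_law_def
  by (rule prob_space_PiM) (auto intro: prob_space_normal_measure split: prod.splits)

lemma sets_cond_law [simp]: "sets (cond_law K \<delta> A) = sets (null_law K)"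
  unfolding cond_law_def null_law_def by (rule sets_PiM_cong) auto

lemma cond_law_measurable:
  "cond_law K \<delta> \<in> measurable (measure_pmf p) (prob_algebra (null_law K))"
  by (auto simp: space_prob_algebra prob_space_cond_law)

lemma prob_space_array_law: "prob_space (array_law K \<epsilon> \<delta>)"
  unfolding array_law_def
  by (rule prob_space_bind'[OF _ cond_law_measurable])
     (simp add: space_prob_algebra prob_space_measure_pmf)

lemma sets_array_law [simp]: "sets (array_law K \<epsilon> \<delta>) = sets (null_law K)"
  unfolding array_law_def by (rule sets_bind) auto

lemma array_law_zero: "array_law K 0 \<delta> = null_law K"
proof -
  have "bernoulli_pmf 0 = return_pmf False"
    by (intro pmf_eqI) (auto simp: pmf_bernoulli_False pmf_bernoulli_True indicator_def
        intro: bool.induct split: bool.splits)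
  then have "measure_pmf (Pi_pmf {1..K} False (\<lambda>_. bernoulli_pmf 0)) =
      return (count_space UNIV) (\<lambda>_. False)"
    by (simp add: Pi_pmf_return_pmf return_pmf.rep_eq)
  moreover have "cond_law K \<delta> \<in> measurable (count_space UNIV) (subprob_algebra (null_law K))"
    using prob_space_cond_law
    by (auto simp: space_subprob_algebra intro: prob_space_imp_subprob_space)
  ultimately show ?thesis
    unfolding array_law_def
    by (simp add: bind_return) (simp add: cond_law_def null_law_def case_prod_beta')
qed

lemma subalgebra_obs_filtration: "subalgebra (null_law K) (obs_filtration K s)"
proof -
  have "(\<lambda>x. x (i, u)) -` B \<inter> space (null_law K) \<in> sets (null_law K)"
    if "i \<in> {1..K}" "u \<in> {1..s}" "B \<in> sets borel" for i u B
  proof (rule measurable_sets[where A = "normal_measure 0"])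
    show "(\<lambda>x. x (i, u)) \<in> measurable (null_law K) (normal_measure 0)"
      unfolding null_law_def
      by (rule measurable_component_singleton) (use that in \<open>auto simp: array_index_def\<close>)
  qed (use that in simp)
  then have "{(\<lambda>x. x (i, u)) -` B \<inter> space (null_law K) | i u B.
        i \<in> {1..K} \<and> u \<in> {1..s} \<and> B \<in> sets borel} \<subseteq> sets (null_law K)"
    by blast
  then show ?thesis
    unfolding subalgebra_def obs_filtration_def
    by (simp add: sets.sigma_sets_subset space_measure_of_conv sets_measure_of_conv)
qed

lemma test_martingale_const: "test_martingale K (\<lambda>_ _. 1)"
proof -
  interpret prob_space "null_law K" by (rule prob_space_null_law)
  have "AE x in null_law K. real_cond_exp (null_law K) (obs_filtration K u) (\<lambda>_. 1) x = 1" for u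
  proof -
    interpret finite_measure_subalgebra "null_law K" "obs_filtration K u"
      by unfold_locales (rule subalgebra_obs_filtration)
    show ?thesis by (rule real_cond_exp_F_meas) auto
  qed
  then show ?thesis by (simp add: test_martingale_def)
qed

end

theory Submission
  imports Defs
begin

text \<open>The idea is to bound the expected logarithm by a Renyi-type divergence of some order
  \<open>p \<in> {1<..2}\<close>. Let \<open>L\<close> be the likelihood ratio of the two laws on the observations up to time
  \<open>t\<close>. With \<open>a = 1 - 1 / p\<close>, the estimate \<open>ln x \<le> (x powr a - 1) / a\<close> and Young's inequality
  \<open>L * x powr a \<le> L powr p / p + a * x\<close> bound the expected logarithm of any nonnegative \<open>X\<close> with
  null mean one by \<open>(E\<^sub>0 L powr p - 1) / (p - 1)\<close>. Since \<open>L\<close> is a product of \<open>K\<close> independent factors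
  \<open>1 + \<epsilon> * (\<Lambda> - 1)\<close> with \<open>\<Lambda>\<close> lognormal, \<open>E\<^sub>0 L powr p\<close> tends to \<open>1\<close> as soon as
  \<open>1 - \<beta> * p + r * (p\<^sup>2 - p) < 0\<close>, where \<open>r = t / T\<close>. Minimising this quadratic over
  \<open>p \<in> {1<..2}\<close> gives exactly the condition that \<open>r\<close> lies below the detection boundary: the
  branch \<open>\<beta> < 3 / 4\<close> corresponds to \<open>p = 2\<close>, the other one to a vanishing discriminant.\<close>

section \<open>Power inequalities for a mixture factor\<close>

text \<open>The first-order term is kept exact so that it integrates to zero for a centred
  \<open>u\<close>, and the remainder has order \<open>p\<close> rather than \<open>2\<close>. For
  \<open>u \<le> 1\<close> write the power as \<open>(1 + u) * (1 + u) powr (p - 1)\<close> and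
  apply Bernoulli's inequality to the second factor; for \<open>u > 1\<close> use
  \<open>1 + u \<le> 2 * u\<close> and \<open>2 powr p \<le> 4\<close>.\<close>

lemma one_plus_powr_le:
  fixes u p :: real
  assumes "1 \<le> p" "p \<le> 2" "- 1 \<le> u"
  shows "(1 + u) powr p \<le> 1 + p * u + 4 * \<bar>u\<bar> powr p"
proof (cases "u \<le> 1")
  case True
  \<comment> \<open>Weighted AM-GM for \<open>1\<close> and \<open>1 + u\<close> with weights
    \<open>2 - p\<close> and \<open>p - 1\<close>. It requires positive arguments, hence the
    separate case \<open>u = - 1\<close>.\<close>
  have "(1 + u) powr (p - 1) \<le> 1 + (p - 1) * u"
  proof (cases "u = - 1")
    case False
    then show ?thesis
      using Youngs_inequality_0[of "2 - p" "p - 1" 1 "1 + u"] assms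
      by (simp add: algebra_simps)
  qed (use assms in simp)
  then have "(1 + u) * (1 + u) powr (p - 1) \<le> (1 + u) * (1 + (p - 1) * u)"
    using assms by (intro mult_left_mono) auto
  moreover have "(1 + u) * (1 + u) powr (p - 1) = (1 + u) powr p"
    using assms powr_mult_base[of "1 + u" "p - 1"] by simp
  moreover have "(p - 1) * u\<^sup>2 \<le> 4 * \<bar>u\<bar> powr p"
  proof (cases "u = 0")
    case False
    then have "u\<^sup>2 \<le> \<bar>u\<bar> powr p"
      using powr_mono'[of p 2 "\<bar>u\<bar>"] assms True by simp
    moreover have "(p - 1) * u\<^sup>2 \<le> 1 * u\<^sup>2"
      using assms by (intro mult_right_mono) auto
    moreover have "0 \<le> \<bar>u\<bar> powr p" by simp
    ultimately show ?thesis by linarith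
  qed simp
  ultimately show ?thesis by (simp add: algebra_simps power2_eq_square)
next
  case False
  then have "(1 + u) powr p \<le> (2 * u) powr p"
    using assms by (intro powr_mono2) auto
  also have "\<dots> = 2 powr p * u powr p"
    by (rule powr_mult)
  also have "\<dots> \<le> 4 * u powr p"
    using assms powr_mono[of p 2 2] by (intro mult_right_mono) auto
  also have "\<dots> \<le> 1 + p * u + 4 * \<bar>u\<bar> powr p"
    using False assms by simp
  finally show ?thesis .
qed

text \<open>The previous bound at \<open>u = \<epsilon> * (l - 1)\<close>. With \<open>l\<close> a
  likelihood ratio, the linear term has null mean zero, so only a term of size
  \<open>\<epsilon> powr p\<close> survives integration.\<close>

lemma mixture_powr_le:
  fixes \<epsilon> l p :: real
  assumes "1 \<le> p" "p \<le> 2" "0 \<le> \<epsilon>" "\<epsilon> \<le> 1" "0 \<le> l"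
  shows "(1 - \<epsilon> + \<epsilon> * l) powr p \<le> 1 + p * \<epsilon> * (l - 1) + 4 * \<epsilon> powr p * (1 + l powr p)"
proof -
  have "- 1 \<le> \<epsilon> * (l - 1)"
  proof -
    have "0 \<le> \<epsilon> * l" using assms by simp
    then show ?thesis using assms(4) by (simp add: right_diff_distrib)
  qed
  from one_plus_powr_le[OF assms(1,2) this]
  have "(1 - \<epsilon> + \<epsilon> * l) powr p \<le> 1 + p * \<epsilon> * (l - 1) + 4 * \<bar>\<epsilon> * (l - 1)\<bar> powr p"
    by (simp add: algebra_simps)
  also have "\<bar>\<epsilon> * (l - 1)\<bar> powr p = \<epsilon> powr p * \<bar>l - 1\<bar> powr p"
    using assms by (simp add: abs_mult powr_mult)
  also have "\<bar>l - 1\<bar> powr p \<le> 1 + l powr p"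
  proof (cases "l \<le> 1")
    case True
    then have "\<bar>l - 1\<bar> powr p \<le> 1" using assms by (intro powr_le1) auto
    moreover have "0 \<le> l powr p" by simp
    ultimately show ?thesis by linarith
  next
    case False
    then have "\<bar>l - 1\<bar> powr p \<le> l powr p" using assms by (intro powr_mono2) auto
    then show ?thesis by simp
  qed
  finally show ?thesis by (simp add: mult_left_mono mult.assoc)
qed

section \<open>Infinite products, independence of coordinates and product densities\<close>

text \<open>The index set \<open>I\<close> may be infinite, but the integrand depends on the
  coordinates in the finite set \<open>J\<close> only, so the integral can be pushed forward along
  the restriction to \<open>J\<close>.\<close>

lemma (in product_prob_space) nn_integral_PiM_prod:
  assumes J: "finite J" "J \<subseteq> I" and f: "\<And>j. j \<in> J \<Longrightarrow> f j \<in> borel_measurable (M j)"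
  shows "(\<integral>\<^sup>+x. (\<Prod>j\<in>J. f j (x j)) \<partial>PiM I M) = (\<Prod>j\<in>J. \<integral>\<^sup>+y. f j y \<partial>M j)"
proof -
  have [measurable]: "(\<lambda>x. restrict x J) \<in> measurable (PiM I M) (PiM J M)"
    using J(2) by (rule measurable_restrict_subset)
  have m: "(\<lambda>x. \<Prod>j\<in>J. f j (x j)) \<in> borel_measurable (PiM J M)"
    using f by (intro borel_measurable_prod_ennreal measurable_compose[OF measurable_component_singleton])
  have "(\<integral>\<^sup>+x. (\<Prod>j\<in>J. f j (x j)) \<partial>PiM I M) = (\<integral>\<^sup>+x. (\<Prod>j\<in>J. f j (restrict x J j)) \<partial>PiM I M)"
    by (intro nn_integral_cong prod.cong) auto
  also have "\<dots> = (\<integral>\<^sup>+x. (\<Prod>j\<in>J. f j (x j)) \<partial>distr (PiM I M) (PiM J M) (\<lambda>x. restrict x J))"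
    using m by (subst nn_integral_distr) auto
  also have "\<dots> = (\<integral>\<^sup>+x. (\<Prod>j\<in>J. f j (x j)) \<partial>PiM J M)"
    using J by (subst distr_PiM_restrict_finite) auto
  also have "\<dots> = (\<Prod>j\<in>J. \<integral>\<^sup>+y. f j y \<partial>M j)"
    using J f by (intro product_nn_integral_prod) auto
  finally show ?thesis .
qed

text \<open>The joint law of all coordinates is \<open>PiM I M\<close> itself, which is the product
  of its marginals. This characterises independence for nonempty \<open>I\<close>.\<close>

lemma (in product_prob_space) indep_vars_PiM_components:
  "P.indep_vars M (\<lambda>i x. x i) I"
proof (cases "I = {}")
  case True
  then show ?thesis unfolding P.indep_vars_def P.indep_sets_def by auto
next
  case False
  have "distr (PiM I M) (PiM I M) (\<lambda>x. \<lambda>i\<in>I. x i) = distr (PiM I M) (PiM I M) (\<lambda>x. x)"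
    by (intro distr_cong) (auto simp: space_PiM restrict_PiE_iff PiE_restrict)
  also have "\<dots> = PiM I (\<lambda>i. distr (PiM I M) (M i) (\<lambda>x. x i))"
    by (auto simp: distr_id2 distr_PiM_component M.prob_space_axioms cong: PiM_cong)
  finally show ?thesis
    using False by (subst P.indep_vars_iff_distr_eq_PiM') auto
qed

text \<open>A finite product measure is determined by its values on boxes, and the indicator of a
  box factorises in the same way as the density.\<close>

lemma (in product_sigma_finite) PiM_density_prod:
  fixes f :: "'i \<Rightarrow> 'a \<Rightarrow> ennreal"
  assumes "finite J" and f: "\<And>j. j \<in> J \<Longrightarrow> f j \<in> borel_measurable (M j)"
    and "\<And>j. sigma_finite_measure (density (M j) (f j))"
  shows "PiM J (\<lambda>j. density (M j) (f j)) = density (PiM J M) (\<lambda>x. \<Prod>j\<in>J. f j (x j))"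
proof -
  interpret D: product_sigma_finite "\<lambda>j. density (M j) (f j)"
    using assms(3) by unfold_locales (simp add: sigma_finite_measure_def)
  have m: "(\<lambda>x. \<Prod>j\<in>J. f j (x j)) \<in> borel_measurable (PiM J M)"
    using f by (intro borel_measurable_prod_ennreal measurable_compose[OF measurable_component_singleton])
  show ?thesis
  proof (rule D.PiM_eqI[symmetric])
    show "sets (density (PiM J M) (\<lambda>x. \<Prod>j\<in>J. f j (x j))) = sets (PiM J (\<lambda>j. density (M j) (f j)))"
      by (auto intro!: sets_PiM_cong)
    fix A assume A: "\<And>i. i \<in> J \<Longrightarrow> A i \<in> sets (density (M i) (f i))"
    have S: "Pi\<^sub>E J A \<in> sets (PiM J M)" using A assms(1) by (intro sets_PiM_I_finite) auto
    have "emeasure (density (PiM J M) (\<lambda>x. \<Prod>j\<in>J. f j (x j))) (Pi\<^sub>E J A)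
       = (\<integral>\<^sup>+x. (\<Prod>j\<in>J. f j (x j)) * indicator (Pi\<^sub>E J A) x \<partial>PiM J M)"
      using m S by (rule emeasure_density)
    also have "\<dots> = (\<integral>\<^sup>+x. (\<Prod>j\<in>J. f j (x j) * indicator (A j) (x j)) \<partial>PiM J M)"
    proof (intro nn_integral_cong)
      fix x assume "x \<in> space (PiM J M)"
      then have "indicator (Pi\<^sub>E J A) x = (\<Prod>j\<in>J. indicator (A j) (x j) :: ennreal)"
        using assms(1) by (auto simp: indicator_def space_PiM PiE_iff prod_zero_iff)
      then show "(\<Prod>j\<in>J. f j (x j)) * indicator (Pi\<^sub>E J A) x = (\<Prod>j\<in>J. f j (x j) * indicator (A j) (x j))"
        by (simp add: prod.distrib)
    qed
    also have "\<dots> = (\<Prod>j\<in>J. \<integral>\<^sup>+y. f j y * indicator (A j) y \<partial>M j)"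
      using assms(1) f A by (intro product_nn_integral_prod) auto
    also have "\<dots> = (\<Prod>j\<in>J. emeasure (density (M j) (f j)) (A j))"
      using f A by (intro prod.cong) (auto simp: emeasure_density)
    finally show "emeasure (density (PiM J M) (\<lambda>x. \<Prod>j\<in>J. f j (x j))) (Pi\<^sub>E J A) = \<dots>" .
  qed fact
qed

section \<open>Gaussian change of measure and the likelihood ratio\<close>

lemma normal_measure_eq_density:
  "normal_measure \<mu> = density (normal_measure 0) (\<lambda>x. ennreal (exp (\<mu> * x - \<mu>\<^sup>2 / 2)))"
proof -
  have "normal_density \<mu> 1 x = normal_density 0 1 x * exp (\<mu> * x - \<mu>\<^sup>2 / 2)" for x
    by (simp add: normal_density_def mult_exp_exp power2_eq_square field_simps)
  then show ?thesis
    unfolding normal_measure_def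
    by (subst density_density_eq) (auto simp: ennreal_mult' intro!: density_cong)
qed

text \<open>No integral is computed: up to a constant the integrand is the density of
  \<open>normal_measure a\<close> with respect to \<open>normal_measure 0\<close>, which has total
  mass one.\<close>

lemma nn_integral_exp_normal_measure:
  "(\<integral>\<^sup>+x. ennreal (exp (a * x - c)) \<partial>normal_measure 0) = ennreal (exp (a\<^sup>2 / 2 - c))"
proof -
  interpret prob_space "normal_measure a" by (rule prob_space_normal_measure)
  have "(\<integral>\<^sup>+x. ennreal (exp (a * x - c)) \<partial>normal_measure 0)
      = (\<integral>\<^sup>+x. ennreal (exp (a\<^sup>2 / 2 - c)) * ennreal (exp (a * x - a\<^sup>2 / 2)) \<partial>normal_measure 0)"
    by (intro nn_integral_cong) (simp add: mult_exp_exp flip: ennreal_mult)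
  also have "\<dots> = ennreal (exp (a\<^sup>2 / 2 - c)) * (\<integral>\<^sup>+x. ennreal (exp (a * x - a\<^sup>2 / 2)) \<partial>normal_measure 0)"
    by (intro nn_integral_cmult) measurable
  also have "(\<integral>\<^sup>+x. ennreal (exp (a * x - a\<^sup>2 / 2)) \<partial>normal_measure 0) = 1"
    using emeasure_space_1 by (subst (asm) (1) normal_measure_eq_density) (simp add: emeasure_density)
  finally show ?thesis by simp
qed

text \<open>Likelihood ratio of one stream with signal against the same stream without it, over
  times \<open>1\<close> to \<open>t\<close>. Averaging it over the Bernoulli indicator of each
  stream gives \<open>mixture_lr\<close>, the likelihood ratio of the whole array.\<close>

definition block_lr :: "real \<Rightarrow> nat \<Rightarrow> (nat \<times> nat \<Rightarrow> real) \<Rightarrow> nat \<Rightarrow> real" where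
  "block_lr \<delta> t x i = (\<Prod>s\<in>{1..t}. exp (\<delta> * x (i, s) - \<delta>\<^sup>2 / 2))"

definition mixture_lr :: "nat \<Rightarrow> real \<Rightarrow> real \<Rightarrow> nat \<Rightarrow> (nat \<times> nat \<Rightarrow> real) \<Rightarrow> real" where
  "mixture_lr K \<epsilon> \<delta> t x = (\<Prod>i\<in>{1..K}. 1 - \<epsilon> + \<epsilon> * block_lr \<delta> t x i)"

lemma block_lr_pos: "0 < block_lr \<delta> t x i"
  by (simp add: block_lr_def prod_pos)

lemma mixture_factor_nonneg:
  assumes "0 \<le> \<epsilon>" "\<epsilon> \<le> 1"
  shows "0 \<le> 1 - \<epsilon> + \<epsilon> * block_lr \<delta> t x i"
  using assms block_lr_pos[of \<delta> t x i] by (intro add_nonneg_nonneg mult_nonneg_nonneg) auto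

lemma mixture_lr_nonneg:
  assumes "0 \<le> \<epsilon>" "\<epsilon> \<le> 1"
  shows "0 \<le> mixture_lr K \<epsilon> \<delta> t x"
  unfolding mixture_lr_def using assms by (intro prod_nonneg mixture_factor_nonneg ballI)

lemma obs_filtration_component:
  assumes "i \<in> {1..K}" "s \<in> {1..t}"
  shows "(\<lambda>x. x (i, s)) \<in> borel_measurable (obs_filtration K t)"
proof (rule measurableI)
  fix B :: "real set" assume "B \<in> sets borel"
  then show "(\<lambda>x. x (i, s)) -` B \<inter> space (obs_filtration K t) \<in> sets (obs_filtration K t)"
    using assms unfolding obs_filtration_def
    by (subst space_measure_of_conv, subst sets_measure_of) (blast intro: sigma_sets.Basic)+
qed simp

lemma block_lr_measurable_obs:
  assumes "i \<in> {1..K}"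
  shows "(\<lambda>x. block_lr \<delta> t x i) \<in> borel_measurable (obs_filtration K t)"
  unfolding block_lr_def using assms
  by (intro borel_measurable_prod borel_measurable_exp borel_measurable_diff borel_measurable_times
      obs_filtration_component borel_measurable_const measurable_compose[OF _ borel_measurable_exp]) auto

lemma mixture_lr_measurable_obs:
  "mixture_lr K \<epsilon> \<delta> t \<in> borel_measurable (obs_filtration K t)"
  unfolding mixture_lr_def
  by (intro borel_measurable_prod borel_measurable_add borel_measurable_times block_lr_measurable_obs) auto

text \<open>This reduces events known at time \<open>t\<close> to events in a finite product. The
  preimages under the restriction map form a sigma-algebra, so it suffices to treat the
  generators.\<close>

lemma sets_obs_filtration_restrict:
  assumes "A \<in> sets (obs_filtration K t)"
  obtains B where "B \<in> sets (PiM ({1..K} \<times> {1..t}) (\<lambda>_. borel))"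
    "A = (\<lambda>x. restrict x ({1..K} \<times> {1..t})) -` B \<inter> space (null_law K)"
proof -
  let ?J = "{1..K} \<times> {1..t}" and ?r = "\<lambda>x::nat \<times> nat \<Rightarrow> real. restrict x ({1..K} \<times> {1..t})"
  let ?N = "PiM ?J (\<lambda>_. borel :: real measure)"
  let ?V = "vimage_algebra (space (null_law K)) ?r ?N"
  have V: "sets ?V = {?r -` B \<inter> space (null_law K) | B. B \<in> sets ?N}"
    by (intro sets_vimage_algebra2) (auto simp: space_PiM)
  have "{(\<lambda>x. x (i, u)) -` B \<inter> space (null_law K) | i u B.
      i \<in> {1..K} \<and> u \<in> {1..t} \<and> B \<in> sets borel} \<subseteq> sets ?V"
  proof safe
    fix i u and B :: "real set" assume iu: "i \<in> {1..K}" "u \<in> {1..t}" and B: "B \<in> sets borel"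
    have "(\<lambda>x. x (i, u)) -` B \<inter> space ?N \<in> sets ?N"
      using iu B by (intro measurable_sets[OF measurable_component_singleton]) auto
    moreover have "(\<lambda>x. x (i, u)) -` B \<inter> space (null_law K)
        = ?r -` ((\<lambda>x. x (i, u)) -` B \<inter> space ?N) \<inter> space (null_law K)"
      using iu by (auto simp: space_PiM)
    ultimately show "(\<lambda>x. x (i, u)) -` B \<inter> space (null_law K) \<in> sets ?V"
      unfolding V by blast
  qed
  from sets.sigma_sets_subset[OF this]
  have "sets (obs_filtration K t) \<subseteq> sets ?V"
    unfolding obs_filtration_def by (subst sets_measure_of) auto
  with assms that show thesis unfolding V by blast
qed

text \<open>The infinite product laws need not be absolutely continuous, so a density is available
  only on events known at time \<open>t\<close>. Such an event is moved to the finite product, the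
  density is inserted there, and the result is pulled back to the null law.\<close>

lemma emeasure_cond_law:
  assumes "A \<in> sets (obs_filtration K t)"
  shows "emeasure (cond_law K \<delta> a) A =
    (\<integral>\<^sup>+x. (\<Prod>i\<in>{1..K}. if a i then ennreal (block_lr \<delta> t x i) else 1) * indicator A x \<partial>null_law K)"
proof -
  define J where "J = {1..K} \<times> {1..t}"
  define m where "m = (\<lambda>(i, s::nat). \<delta> * of_bool (a i))"
  define f where "f = (\<lambda>j y. ennreal (exp (m j * y - (m j)\<^sup>2 / 2)))"
  let ?r = "\<lambda>x::nat \<times> nat \<Rightarrow> real. restrict x J"
  have J: "finite J" "J \<subseteq> array_index K" by (auto simp: J_def array_index_def)
  interpret N: product_prob_space "\<lambda>_::nat \<times> nat. normal_measure 0" "array_index K"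
    by (intro product_prob_spaceI prob_space_normal_measure)
  interpret M: product_prob_space "\<lambda>j::nat \<times> nat. normal_measure (m j)" "array_index K"
    by (intro product_prob_spaceI prob_space_normal_measure)
  have cond: "cond_law K \<delta> a = PiM (array_index K) (\<lambda>j. normal_measure (m j))"
    unfolding cond_law_def m_def by (simp add: case_prod_beta')
  \<comment> \<open>\<open>m\<close> is bound afresh here and in \<open>r\<close>, so that both
    facts also serve for the null means \<open>\<lambda>_. 0\<close>.\<close>
  have sJ: "sets (PiM J (\<lambda>j. normal_measure (m j))) = sets (PiM J (\<lambda>_. borel))" for m
    by (intro sets_PiM_cong) auto
  obtain B where B: "B \<in> sets (PiM J (\<lambda>_. borel))" and A: "A = ?r -` B \<inter> space (null_law K)"
    using sets_obs_filtration_restrict[OF assms] unfolding J_def by blast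
  have f: "f j \<in> borel_measurable (normal_measure 0)" for j unfolding f_def by measurable
  have dens: "normal_measure (m j) = density (normal_measure 0) (f j)" for j
    unfolding f_def by (rule normal_measure_eq_density)
  have spc: "space (PiM (array_index K) (\<lambda>j. normal_measure (m j))) = space (null_law K)"
    by (simp add: null_law_def space_PiM)
  have r: "?r \<in> measurable (PiM (array_index K) (\<lambda>j. normal_measure (m j))) (PiM J (\<lambda>j. normal_measure (m j)))" for m
    using J(2) by (rule measurable_restrict_subset)
  have pm: "(\<lambda>x. \<Prod>j\<in>J. f j (x j)) \<in> borel_measurable (PiM J (\<lambda>_. normal_measure 0))"
    by (intro borel_measurable_prod_ennreal measurable_compose[OF measurable_component_singleton] f) auto
  have "emeasure (cond_law K \<delta> a) A = emeasure (distr (PiM (array_index K) (\<lambda>j. normal_measure (m j)))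
      (PiM J (\<lambda>j. normal_measure (m j))) ?r) B"
    unfolding cond A using B r by (subst emeasure_distr) (auto simp: sJ spc)
  also have "\<dots> = emeasure (PiM J (\<lambda>j. normal_measure (m j))) B"
    using J by (subst M.distr_PiM_restrict_finite) auto
  also have "\<dots> = emeasure (density (PiM J (\<lambda>_. normal_measure 0)) (\<lambda>x. \<Prod>j\<in>J. f j (x j))) B"
  proof -
    have "sigma_finite_measure (density (normal_measure 0) (f j))" for j
      unfolding dens[symmetric] by (intro prob_space_imp_sigma_finite prob_space_normal_measure)
    then show ?thesis
      using J(1) f unfolding dens by (subst N.PiM_density_prod) auto
  qed
  also have "\<dots> = (\<integral>\<^sup>+x. (\<Prod>j\<in>J. f j (x j)) * indicator B x \<partial>PiM J (\<lambda>_. normal_measure 0))"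
    using pm B sJ[of "\<lambda>_. 0"] by (intro emeasure_density) auto
  also have "\<dots> = (\<integral>\<^sup>+x. (\<Prod>j\<in>J. f j (x j)) * indicator B x
      \<partial>distr (null_law K) (PiM J (\<lambda>_. normal_measure 0)) ?r)"
    unfolding null_law_def using J by (subst N.distr_PiM_restrict_finite) auto
  also have "\<dots> = (\<integral>\<^sup>+x. (\<Prod>j\<in>J. f j (?r x j)) * indicator B (?r x) \<partial>null_law K)"
    using pm B sJ[of "\<lambda>_. 0"] r[of "\<lambda>_. 0"] unfolding null_law_def
    by (intro nn_integral_distr borel_measurable_times_ennreal) auto
  also have "\<dots> = (\<integral>\<^sup>+x. (\<Prod>i\<in>{1..K}. if a i then ennreal (block_lr \<delta> t x i) else 1) * indicator A x \<partial>null_law K)"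
  proof (intro nn_integral_cong arg_cong2[where f = "(*)"])
    fix x assume "x \<in> space (null_law K)"
    then show "indicator B (?r x) = (indicator A x :: ennreal)"
      by (auto simp: A indicator_def)
    have "(\<Prod>j\<in>J. f j (?r x j)) = (\<Prod>j\<in>J. f j (x j))" by (intro prod.cong) auto
    also have "\<dots> = (\<Prod>i\<in>{1..K}. \<Prod>s\<in>{1..t}. f (i, s) (x (i, s)))"
      unfolding J_def by (simp add: prod.cartesian_product)
    \<comment> \<open>A stream without signal has mean \<open>0\<close>, so each of its tilts is
      \<open>exp 0 = 1\<close>.\<close>
    also have "\<dots> = (\<Prod>i\<in>{1..K}. if a i then ennreal (block_lr \<delta> t x i) else 1)"
      by (intro prod.cong) (auto simp: f_def m_def block_lr_def prod_ennreal)
    finally show "(\<Prod>j\<in>J. f j (?r x j)) = \<dots>" .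
  qed
  finally show ?thesis .
qed

text \<open>Average the conditional densities over the latent indicators. Their law has finite
  support, so the average is a finite sum that passes under the integral; independence of the
  indicators then turns the mean of the product into the product of the Bernoulli means.\<close>

lemma emeasure_array_law:
  assumes A: "A \<in> sets (obs_filtration K t)" and \<epsilon>: "0 \<le> \<epsilon>" "\<epsilon> \<le> 1"
  shows "emeasure (array_law K \<epsilon> \<delta>) A =
    (\<integral>\<^sup>+x. ennreal (mixture_lr K \<epsilon> \<delta> t x) * indicator A x \<partial>null_law K)"
proof -
  let ?p = "Pi_pmf {1..K} False (\<lambda>_. bernoulli_pmf \<epsilon>)"
  let ?w = "\<lambda>x b i. if b then ennreal (block_lr \<delta> t x i) else 1"
  have sub: "subalgebra (null_law K) (obs_filtration K t)" by (rule subalgebra_obs_filtration)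
  then have A': "A \<in> sets (null_law K)" using A by (auto simp: subalgebra_def)
  have fin: "finite (set_pmf ?p)"
    by (rule finite_subset[OF set_Pi_pmf_subset']) (auto intro!: finite_PiE_dflt)
  have m: "(\<lambda>x. ?w x b i) \<in> borel_measurable (null_law K)" if "i \<in> {1..K}" for b i
    using measurable_from_subalg[OF sub block_lr_measurable_obs[OF that]] by (cases b) auto
  have m': "(\<lambda>x. (\<Prod>i\<in>{1..K}. ?w x (a i) i) * indicator A x) \<in> borel_measurable (null_law K)" for a
    using A' by (intro borel_measurable_times_ennreal borel_measurable_prod_ennreal m) auto
  have "emeasure (array_law K \<epsilon> \<delta>) A = (\<integral>\<^sup>+a. emeasure (cond_law K \<delta> a) A \<partial>?p)"
    unfolding array_law_def using A'
    by (intro emeasure_bind[OF _ measurable_prob_algebraD[OF cond_law_measurable]]) auto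
  also have "\<dots> = (\<Sum>a\<in>set_pmf ?p. (\<integral>\<^sup>+x. (\<Prod>i\<in>{1..K}. ?w x (a i) i) * indicator A x \<partial>null_law K) * pmf ?p a)"
    using fin by (simp add: nn_integral_measure_pmf_finite emeasure_cond_law[OF A])
  also have "\<dots> = (\<integral>\<^sup>+x. (\<Sum>a\<in>set_pmf ?p. (\<Prod>i\<in>{1..K}. ?w x (a i) i) * indicator A x * pmf ?p a) \<partial>null_law K)"
    using m' by (simp add: nn_integral_sum nn_integral_multc)
  also have "\<dots> = (\<integral>\<^sup>+x. ennreal (mixture_lr K \<epsilon> \<delta> t x) * indicator A x \<partial>null_law K)"
  proof (intro nn_integral_cong)
    fix x
    have "(\<Sum>a\<in>set_pmf ?p. (\<Prod>i\<in>{1..K}. ?w x (a i) i) * indicator A x * pmf ?p a)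
        = (\<Sum>a\<in>set_pmf ?p. (\<Prod>i\<in>{1..K}. ?w x (a i) i) * pmf ?p a) * indicator A x"
      unfolding sum_distrib_right by (intro sum.cong) (simp_all add: mult_ac)
    also have "(\<Sum>a\<in>set_pmf ?p. (\<Prod>i\<in>{1..K}. ?w x (a i) i) * pmf ?p a)
        = (\<integral>\<^sup>+a. (\<Prod>i\<in>{1..K}. ?w x (a i) i) \<partial>?p)"
      using fin by (simp add: nn_integral_measure_pmf_finite)
    also have "\<dots> = (\<Prod>i\<in>{1..K}. \<integral>\<^sup>+b. ?w x b i \<partial>bernoulli_pmf \<epsilon>)"
      by (rule nn_integral_prod_Pi_pmf[of "{1..K}" False "\<lambda>_. bernoulli_pmf \<epsilon>" "\<lambda>i b. ?w x b i"]) simp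
    also have "\<dots> = (\<Prod>i\<in>{1..K}. ennreal (1 - \<epsilon> + \<epsilon> * block_lr \<delta> t x i))"
    proof (intro prod.cong refl)
      fix i
      have "(\<integral>\<^sup>+b. ?w x b i \<partial>bernoulli_pmf \<epsilon>) = ennreal (block_lr \<delta> t x i) * ennreal \<epsilon> + ennreal (1 - \<epsilon>)"
        using \<epsilon> by (simp add: nn_integral_measure_pmf_finite[of "bernoulli_pmf \<epsilon>"] nn_integral_bernoulli_pmf)
      also have "\<dots> = ennreal (1 - \<epsilon> + \<epsilon> * block_lr \<delta> t x i)"
        using \<epsilon> block_lr_pos[of \<delta> t x i]
        by (simp add: ennreal_plus[symmetric] ennreal_mult'[symmetric] mult_ac add_ac del: ennreal_plus)
      finally show "(\<integral>\<^sup>+b. ?w x b i \<partial>bernoulli_pmf \<epsilon>) = ennreal (1 - \<epsilon> + \<epsilon> * block_lr \<delta> t x i)" .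
    qed
    also have "\<dots> = ennreal (mixture_lr K \<epsilon> \<delta> t x)"
      unfolding mixture_lr_def using \<epsilon> by (intro prod_ennreal mixture_factor_nonneg)
    finally show "(\<Sum>a\<in>set_pmf ?p. (\<Prod>i\<in>{1..K}. ?w x (a i) i) * indicator A x * pmf ?p a)
        = ennreal (mixture_lr K \<epsilon> \<delta> t x) * indicator A x" .
  qed
  finally show ?thesis .
qed

text \<open>After restriction of both laws to the sigma-algebra of time \<open>t\<close>, the
  formula for events says that one has density \<open>mixture_lr\<close> with respect to the other;
  this carries over to integrals.\<close>

lemma nn_integral_array_law:
  fixes h :: "(nat \<times> nat \<Rightarrow> real) \<Rightarrow> ennreal"
  assumes h: "h \<in> borel_measurable (obs_filtration K t)" and \<epsilon>: "0 \<le> \<epsilon>" "\<epsilon> \<le> 1"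
  shows "(\<integral>\<^sup>+x. h x \<partial>array_law K \<epsilon> \<delta>) = (\<integral>\<^sup>+x. ennreal (mixture_lr K \<epsilon> \<delta> t x) * h x \<partial>null_law K)"
proof -
  let ?F = "obs_filtration K t" and ?L = "\<lambda>x. ennreal (mixture_lr K \<epsilon> \<delta> t x)"
  have subP: "subalgebra (null_law K) ?F" by (rule subalgebra_obs_filtration)
  have subQ: "subalgebra (array_law K \<epsilon> \<delta>) ?F"
    using subP sets_eq_imp_space_eq[OF sets_array_law] by (simp add: subalgebra_def)
  have L: "?L \<in> borel_measurable ?F" using mixture_lr_measurable_obs by measurable
  have eq: "restr_to_subalg (array_law K \<epsilon> \<delta>) ?F = density (restr_to_subalg (null_law K) ?F) ?L"
  proof (rule measure_eqI)
    fix A assume "A \<in> sets (restr_to_subalg (array_law K \<epsilon> \<delta>) ?F)"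
    then have A: "A \<in> sets ?F" by (simp add: sets_restr_to_subalg[OF subQ])
    have "emeasure (density (restr_to_subalg (null_law K) ?F) ?L) A
        = (\<integral>\<^sup>+x. ?L x * indicator A x \<partial>restr_to_subalg (null_law K) ?F)"
      using A L by (intro emeasure_density measurable_in_subalg[OF subP]) (auto simp: sets_restr_to_subalg[OF subP])
    also have "\<dots> = (\<integral>\<^sup>+x. ?L x * indicator A x \<partial>null_law K)"
      using A L by (intro nn_integral_subalgebra2[OF subP]) auto
    finally show "emeasure (restr_to_subalg (array_law K \<epsilon> \<delta>) ?F) A =
        emeasure (density (restr_to_subalg (null_law K) ?F) ?L) A"
      by (simp add: emeasure_restr_to_subalg[OF subQ A] emeasure_array_law[OF A \<epsilon>])
  qed (simp add: sets_restr_to_subalg[OF subP] sets_restr_to_subalg[OF subQ])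
  have "(\<integral>\<^sup>+x. h x \<partial>array_law K \<epsilon> \<delta>) = (\<integral>\<^sup>+x. h x \<partial>restr_to_subalg (array_law K \<epsilon> \<delta>) ?F)"
    using h by (rule nn_integral_subalgebra2[OF subQ, symmetric])
  also have "\<dots> = (\<integral>\<^sup>+x. ?L x * h x \<partial>restr_to_subalg (null_law K) ?F)"
    unfolding eq using h L by (intro nn_integral_density measurable_in_subalg[OF subP])
  also have "\<dots> = (\<integral>\<^sup>+x. ?L x * h x \<partial>null_law K)"
    using h L by (intro nn_integral_subalgebra2[OF subP]) auto
  finally show ?thesis .
qed

section \<open>Moments of the likelihood ratio under the null law\<close>

lemma block_lr_restrict:
  assumes "{i} \<times> {1..t} \<subseteq> J"
  shows "block_lr \<delta> t (restrict x J) i = block_lr \<delta> t x i"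
proof -
  have "(i, s) \<in> J" if "s \<in> {1..t}" for s using assms that by auto
  then show ?thesis unfolding block_lr_def by (intro prod.cong) auto
qed

text \<open>The \<open>a\<close>-th power of each tilt is again an exponential of a linear function,
  so each of the \<open>t\<close> independent factors contributes a Gaussian exponential
  moment.\<close>

lemma nn_integral_block_lr_powr:
  assumes "i \<in> {1..K}"
  shows "(\<integral>\<^sup>+x. ennreal (block_lr \<delta> t x i powr a) \<partial>null_law K) =
    ennreal (exp (real t * \<delta>\<^sup>2 / 2 * (a\<^sup>2 - a)))"
proof -
  interpret N: product_prob_space "\<lambda>_::nat \<times> nat. normal_measure 0" "array_index K"
    by (intro product_prob_spaceI prob_space_normal_measure)
  have "ennreal (block_lr \<delta> t x i powr a)
      = (\<Prod>j\<in>{i} \<times> {1..t}. ennreal (exp (a * \<delta> * x j - a * \<delta>\<^sup>2 / 2)))" for x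
  proof -
    have "block_lr \<delta> t x i powr a = (\<Prod>s\<in>{1..t}. exp (a * \<delta> * x (i, s) - a * \<delta>\<^sup>2 / 2))"
      unfolding block_lr_def powr_def
      by (simp add: exp_sum[symmetric] sum_distrib_left algebra_simps)
    moreover have "(\<Prod>j\<in>{i} \<times> {1..t}. f j) = (\<Prod>s\<in>{1..t}. f (i, s))" for f :: "nat \<times> nat \<Rightarrow> real"
      using prod.cartesian_product[of "\<lambda>i s. f (i, s)" "{1..t}" "{i}"] by simp
    ultimately show ?thesis by (simp add: prod_ennreal)
  qed
  then have "(\<integral>\<^sup>+x. ennreal (block_lr \<delta> t x i powr a) \<partial>null_law K)
      = (\<integral>\<^sup>+x. (\<Prod>j\<in>{i} \<times> {1..t}. ennreal (exp (a * \<delta> * x j - a * \<delta>\<^sup>2 / 2))) \<partial>null_law K)"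
    by simp
  also have "\<dots> = (\<Prod>j\<in>{i} \<times> {1..t}. \<integral>\<^sup>+y. ennreal (exp (a * \<delta> * y - a * \<delta>\<^sup>2 / 2)) \<partial>normal_measure 0)"
    unfolding null_law_def using assms by (intro N.nn_integral_PiM_prod) (auto simp: array_index_def)
  also have "\<dots> = (\<Prod>j\<in>{i} \<times> {1..t}. ennreal (exp ((a * \<delta>)\<^sup>2 / 2 - a * \<delta>\<^sup>2 / 2)))"
    by (intro prod.cong nn_integral_exp_normal_measure refl)
  also have "\<dots> = ennreal (exp (real t * \<delta>\<^sup>2 / 2 * (a\<^sup>2 - a)))"
    by (simp add: ennreal_power exp_of_nat_mult[symmetric] power_mult_distrib algebra_simps diff_divide_distrib)
  finally show ?thesis .
qed

text \<open>Distinct streams read disjoint sets of independent coordinates.\<close>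

lemma indep_vars_blocks:
  assumes g: "\<And>i. i \<in> {1..K} \<Longrightarrow> g i \<in> measurable borel N"
  shows "prob_space.indep_vars (null_law K) (\<lambda>_. N) (\<lambda>i x. g i (block_lr \<delta> t x i)) {1..K}"
proof -
  interpret N: product_prob_space "\<lambda>_::nat \<times> nat. normal_measure 0" "array_index K"
    by (intro product_prob_spaceI prob_space_normal_measure)
  have "N.indep_vars (\<lambda>i. PiM ({i} \<times> {1..t}) (\<lambda>_. normal_measure 0))
      (\<lambda>i x. restrict (\<lambda>j. x j) ({i} \<times> {1..t})) {1..K}"
    by (rule N.indep_vars_restrict[OF N.indep_vars_PiM_components])
       (auto simp: array_index_def disjoint_family_on_def)
  moreover have "(\<lambda>y. g i (block_lr \<delta> t y i))
      \<in> measurable (PiM ({i} \<times> {1..t}) (\<lambda>_. normal_measure 0)) N" if "i \<in> {1..K}" for i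
    unfolding block_lr_def
    by (intro measurable_compose[OF _ g] that) measurable
  ultimately have "N.indep_vars (\<lambda>_. N)
      (\<lambda>i x. g i (block_lr \<delta> t (restrict (\<lambda>j. x j) ({i} \<times> {1..t})) i)) {1..K}"
    by (rule N.indep_vars_compose2)
  then show ?thesis
    by (simp add: block_lr_restrict null_law_def)
qed

lemma nn_integral_mixture_factor_powr_le:
  assumes p: "1 \<le> p" "p \<le> 2" and \<epsilon>: "0 \<le> \<epsilon>" "\<epsilon> \<le> 1" and i: "i \<in> {1..K}"
  shows "(\<integral>\<^sup>+x. ennreal ((1 - \<epsilon> + \<epsilon> * block_lr \<delta> t x i) powr p) \<partial>null_law K) \<le>
    ennreal (1 + 4 * \<epsilon> powr p * (1 + exp (real t * \<delta>\<^sup>2 / 2 * (p\<^sup>2 - p))))"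
proof -
  interpret prob_space "null_law K" by (rule prob_space_null_law)
  let ?b = "\<lambda>x. block_lr \<delta> t x i"
  define m where "m = exp (real t * \<delta>\<^sup>2 / 2 * (p\<^sup>2 - p))"
  have [measurable]: "?b \<in> borel_measurable (null_law K)"
    by (rule measurable_from_subalg[OF subalgebra_obs_filtration block_lr_measurable_obs[OF i]])
  \<comment> \<open>The moment formula at \<open>a = 1\<close>, where \<open>a\<^sup>2 - a\<close>
    vanishes; this mean cancels the linear term of \<open>?u\<close>.\<close>
  have 1: "has_bochner_integral (null_law K) ?b 1"
    using nn_integral_block_lr_powr[OF i, of \<delta> t 1] block_lr_pos[of \<delta> t _ i]
    by (intro has_bochner_integral_nn_integral) (auto simp: less_imp_le abs_of_pos)
  have 2: "has_bochner_integral (null_law K) (\<lambda>x. ?b x powr p) m"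
    using nn_integral_block_lr_powr[OF i, of \<delta> t p]
    by (intro has_bochner_integral_nn_integral) (auto simp: m_def)
  let ?u = "\<lambda>x. 1 + p * \<epsilon> * (?b x - 1) + 4 * \<epsilon> powr p * (1 + ?b x powr p)"
  have le: "(1 - \<epsilon> + \<epsilon> * ?b x) powr p \<le> ?u x" for x
    using p \<epsilon> block_lr_pos[of \<delta> t x i] by (intro mixture_powr_le) auto
  have "has_bochner_integral (null_law K) (\<lambda>_. 1) (1::real)"
    by (simp add: prob_space has_bochner_integral_iff)
  then have u: "has_bochner_integral (null_law K) ?u (1 + p * \<epsilon> * (1 - 1) + 4 * \<epsilon> powr p * (1 + m))"
    using 1 2 by (intro has_bochner_integral_add has_bochner_integral_mult_right has_bochner_integral_diff)
  have "(\<integral>\<^sup>+x. ennreal ((1 - \<epsilon> + \<epsilon> * ?b x) powr p) \<partial>null_law K) \<le> (\<integral>\<^sup>+x. ennreal (?u x) \<partial>null_law K)"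
    by (intro nn_integral_mono ennreal_leI le)
  \<comment> \<open>\<open>?u\<close> is nonnegative because it dominates a power.\<close>
  also have "\<dots> = ennreal (1 + 4 * \<epsilon> powr p * (1 + m))"
    using u order_trans[OF _ le] by (subst nn_integral_eq_integral) (auto simp: has_bochner_integral_iff)
  finally show ?thesis by (simp add: m_def)
qed

lemma nn_integral_mixture_lr_powr_le:
  assumes p: "1 \<le> p" "p \<le> 2" and \<epsilon>: "0 \<le> \<epsilon>" "\<epsilon> \<le> 1"
  shows "(\<integral>\<^sup>+x. ennreal (mixture_lr K \<epsilon> \<delta> t x powr p) \<partial>null_law K) \<le>
    ennreal ((1 + 4 * \<epsilon> powr p * (1 + exp (real t * \<delta>\<^sup>2 / 2 * (p\<^sup>2 - p)))) ^ K)"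
proof -
  interpret prob_space "null_law K" by (rule prob_space_null_law)
  let ?g = "\<lambda>l. ennreal ((1 - \<epsilon> + \<epsilon> * l) powr p)"
  have "ennreal (mixture_lr K \<epsilon> \<delta> t x powr p) = (\<Prod>i\<in>{1..K}. ?g (block_lr \<delta> t x i))" for x
    unfolding mixture_lr_def using mixture_factor_nonneg[OF \<epsilon>]
    by (subst prod_powr_distrib) (auto simp: prod_ennreal)
  then have "(\<integral>\<^sup>+x. ennreal (mixture_lr K \<epsilon> \<delta> t x powr p) \<partial>null_law K)
      = (\<integral>\<^sup>+x. (\<Prod>i\<in>{1..K}. ?g (block_lr \<delta> t x i)) \<partial>null_law K)"
    by simp
  also have "\<dots> = (\<Prod>i\<in>{1..K}. \<integral>\<^sup>+x. ?g (block_lr \<delta> t x i) \<partial>null_law K)"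
    by (intro indep_vars_nn_integral indep_vars_blocks) auto
  also have "\<dots> \<le> (\<Prod>i\<in>{1..K}. ennreal (1 + 4 * \<epsilon> powr p * (1 + exp (real t * \<delta>\<^sup>2 / 2 * (p\<^sup>2 - p)))))"
    by (intro prod_mono_ennreal nn_integral_mixture_factor_powr_le p \<epsilon>)
  also have "\<dots> = ennreal ((1 + 4 * \<epsilon> powr p * (1 + exp (real t * \<delta>\<^sup>2 / 2 * (p\<^sup>2 - p)))) ^ K)"
    by (simp add: ennreal_power del: ennreal_plus)
  finally show ?thesis .
qed

section \<open>Bounding the expected logarithm by a moment of the likelihood ratio\<close>

lemma ext_ln_measurable [measurable]: "ext_ln \<in> borel_measurable borel"
  unfolding ext_ln_def by measurable

text \<open>\<open>ln X \<le> c * (X powr a - 1)\<close> reduces the claim to the mean of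
  \<open>X powr a\<close> under \<open>Q\<close>, which becomes a null mean of
  \<open>L * X powr a\<close> and splits by Young's inequality. Since \<open>X\<close> may vanish,
  the positive part \<open>A\<close> and the negative part \<open>B\<close> of the logarithm are
  compared as extended nonnegative numbers, without subtraction until the end.\<close>

lemma ext_expectation_ln_le:
  fixes X L :: "'a \<Rightarrow> real"
  assumes Q: "prob_space Q"
    and sub: "subalgebra P F" "subalgebra Q F"
    and X: "X \<in> borel_measurable F" and L: "L \<in> borel_measurable F" "\<And>x. 0 \<le> L x"
    and Q_eq: "\<And>h. h \<in> borel_measurable F \<Longrightarrow> (\<integral>\<^sup>+x. h x \<partial>Q) = (\<integral>\<^sup>+x. ennreal (L x) * h x \<partial>P)"
    and X_nonneg: "AE x in P. 0 \<le> X x" and X_int: "integrable P X" "(\<integral>x. X x \<partial>P) \<le> 1"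
    and p: "1 < p" and m: "0 \<le> m" "(\<integral>\<^sup>+x. ennreal (L x powr p) \<partial>P) \<le> ennreal m"
  shows "ext_expectation Q (\<lambda>x. ext_ln (X x)) \<le> ereal ((m - 1) / (p - 1))"
proof -
  interpret Q: prob_space Q by fact
  \<comment> \<open>\<open>1 / p\<close> and \<open>a\<close> are the weights in Young's inequality,
    and \<open>c = 1 / a\<close> is the constant in the bound on the logarithm.\<close>
  define a where "a = (p - 1) / p"
  define c where "c = p / (p - 1)"
  have a: "0 < a" "1 / p + a = 1" and c: "0 < c" "c * a = 1"
    using p by (simp_all add: a_def c_def field_simps)
  have Xa: "(\<lambda>x. ennreal (c * max 0 (X x) powr a)) \<in> borel_measurable F"
    using X by measurable
  have [measurable]: "X \<in> borel_measurable P" "X \<in> borel_measurable Q" "L \<in> borel_measurable P"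
    using X L sub measurable_from_subalg by blast+
  define A where "A = (\<integral>\<^sup>+x. e2ennreal (max 0 (ext_ln (X x))) \<partial>Q)"
  define B where "B = (\<integral>\<^sup>+x. e2ennreal (max 0 (- ext_ln (X x))) \<partial>Q)"
  define H where "H = (\<integral>\<^sup>+x. ennreal (c * max 0 (X x) powr a) \<partial>Q)"
  have ln_le: "ln y + c \<le> c * y powr a" if "0 < y" for y
  proof -
    have "ln y = c * ln (y powr a)" using that c a by (simp add: ln_powr)
    also have "\<dots> \<le> c * (y powr a - 1)"
      using that c by (intro mult_left_mono ln_le_minus_one) auto
    finally show ?thesis by (simp add: algebra_simps)
  qed
  \<comment> \<open>The bound on the logarithm with all negative terms moved across; for
    \<open>y \<le> 0\<close> the right-hand side is infinite.\<close>
  have pw: "e2ennreal (max 0 (ext_ln y)) + ennreal c \<le> ennreal (c * max 0 y powr a) + e2ennreal (max 0 (- ext_ln y))" for y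
  proof (cases "0 < y")
    case True
    have "max 0 (ln y) + c \<le> c * y powr a + max 0 (- ln y)"
      using ln_le[OF True] by simp
    then have "ennreal (max 0 (ln y) + c) \<le> ennreal (c * y powr a + max 0 (- ln y))"
      by (rule ennreal_leI)
    then show ?thesis
      using True c by (simp add: ext_ln_def zero_ereal_def flip: ereal_max)
  next
    case False
    then show ?thesis by (simp add: ext_ln_def top_ennreal.abs_eq[symmetric] e2ennreal_infty)
  qed
  \<comment> \<open>This makes \<open>A\<close> finite, which excludes the case where both parts are
    infinite and the expectation is \<open>\<infinity>\<close> by convention.\<close>
  have pw2: "e2ennreal (max 0 (ext_ln y)) \<le> ennreal (c * max 0 y powr a)" for y
  proof (cases "0 < y")
    case True
    have "max 0 (ln y) \<le> c * y powr a"
      using ln_le[OF True] c by simp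
    then have "ennreal (max 0 (ln y)) \<le> ennreal (c * y powr a)"
      by (rule ennreal_leI)
    then show ?thesis
      using True by (simp add: ext_ln_def zero_ereal_def flip: ereal_max)
  next
    case False
    then show ?thesis by (simp add: ext_ln_def)
  qed
  have "A + ennreal c = (\<integral>\<^sup>+x. e2ennreal (max 0 (ext_ln (X x))) + ennreal c \<partial>Q)"
    unfolding A_def by (subst nn_integral_add) (auto simp: Q.emeasure_space_1)
  also have "\<dots> \<le> (\<integral>\<^sup>+x. ennreal (c * max 0 (X x) powr a) + e2ennreal (max 0 (- ext_ln (X x))) \<partial>Q)"
    by (intro nn_integral_mono pw)
  also have "\<dots> = H + B"
    unfolding H_def B_def by (subst nn_integral_add) auto
  finally have AB: "A + ennreal c \<le> H + B" .
  have AH: "A \<le> H" unfolding A_def H_def by (intro nn_integral_mono pw2)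
  have young: "l * y powr a \<le> l powr p / p + a * y" if "0 \<le> l" "0 \<le> y" for l y
  proof (cases "l = 0 \<or> y = 0")
    case False
    then show ?thesis
      using Youngs_inequality_0[of "1 / p" a "l powr p" y] that a p by (simp add: powr_powr)
  qed (use that a p in auto)
  have "H = (\<integral>\<^sup>+x. ennreal (L x) * ennreal (c * max 0 (X x) powr a) \<partial>P)"
    unfolding H_def using Xa by (rule Q_eq)
  also have "\<dots> \<le> (\<integral>\<^sup>+x. ennreal (c / p) * ennreal (L x powr p) + ennreal (X x) \<partial>P)"
  proof (intro nn_integral_mono_AE, use X_nonneg in eventually_elim)
    case (elim x)
    have "L x * (c * X x powr a) = c * (L x * X x powr a)" by simp
    also have "\<dots> \<le> c * (L x powr p / p + a * X x)"
      using young[of "L x" "X x"] elim L c by (intro mult_left_mono) auto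
    \<comment> \<open>By \<open>c * a = 1\<close> the coefficient of \<open>X\<close> is exactly
      one, so its null mean contributes at most one.\<close>
    also have "\<dots> = c / p * L x powr p + X x"
      using c by (simp add: distrib_left mult.assoc[symmetric])
    finally have "ennreal (L x * (c * X x powr a)) \<le> ennreal (c / p * L x powr p + X x)"
      by (rule ennreal_leI)
    moreover have "ennreal (c / p * L x powr p + X x) = ennreal (c / p) * ennreal (L x powr p) + ennreal (X x)"
      using elim c p by (simp flip: ennreal_mult')
    moreover have "ennreal (L x * (c * X x powr a)) = ennreal (L x) * ennreal (c * X x powr a)"
      using L(2)[of x] c by (intro ennreal_mult) auto
    ultimately show ?case using elim by (simp add: max_absorb2)
  qed
  also have "\<dots> = ennreal (c / p) * (\<integral>\<^sup>+x. ennreal (L x powr p) \<partial>P) + (\<integral>\<^sup>+x. ennreal (X x) \<partial>P)"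
    by (subst nn_integral_add) (auto simp: nn_integral_cmult)
  also have "\<dots> \<le> ennreal (c / p) * ennreal m + ennreal 1"
    using X_int X_nonneg by (intro add_mono mult_left_mono m) (auto simp: nn_integral_eq_integral)
  also have "\<dots> = ennreal (m / (p - 1) + 1)"
  proof -
    have "c / p * m = m / (p - 1)" using p by (simp add: c_def)
    moreover have "ennreal (c / p * m + 1) = ennreal (c / p) * ennreal m + ennreal 1"
      using p m(1) c by (simp flip: ennreal_mult')
    ultimately show ?thesis by simp
  qed
  finally have H: "H \<le> ennreal (m / (p - 1) + 1)" .
  have goal: "enn2ereal A - enn2ereal B \<le> ereal ((m - 1) / (p - 1))"
  proof (cases B)
    case top
    moreover from AH H have "A \<noteq> \<top>" by (auto simp: top_unique)
    ultimately show ?thesis by (cases A) auto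
  next
    case (real \<beta>)
    from AH H have "A \<noteq> \<top>" by (auto simp: top_unique)
    then obtain \<alpha> where \<alpha>: "A = ennreal \<alpha>" "0 \<le> \<alpha>" by (cases A) auto
    have "A + ennreal c \<le> ennreal (m / (p - 1) + 1) + B"
      using AB H by (meson add_right_mono order_trans)
    then have "ennreal (\<alpha> + c) \<le> ennreal (m / (p - 1) + 1 + \<beta>)"
      using \<alpha> real c m p by simp
    then have "\<alpha> + c \<le> m / (p - 1) + 1 + \<beta>"
      using real m p by (subst (asm) ennreal_le_iff) auto
    \<comment> \<open>The constant \<open>c = 1 + 1 / (p - 1)\<close> is what replaces
      \<open>m\<close> by \<open>m - 1\<close>, so that the bound vanishes as \<open>m\<close> tends
      to one.\<close>
    moreover have "(m - 1) / (p - 1) = m / (p - 1) + 1 - c"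
      using p by (simp add: c_def divide_simps)
    ultimately have "\<alpha> - \<beta> \<le> (m - 1) / (p - 1)" by linarith
    then show ?thesis using \<alpha> real by simp
  qed
  then show ?thesis unfolding ext_expectation_def A_def B_def .
qed

section \<open>Choice of the order \<open>p\<close> below the detection boundary\<close>

text \<open>The order \<open>p = 2\<close> works exactly when \<open>r < \<beta> - 1 / 2\<close>.
  Otherwise the vertex of the quadratic is used, where the value is negative if and only if
  \<open>4 * r < (\<beta> + r)\<^sup>2\<close>.\<close>

lemma exists_negative_exponent:
  fixes \<beta> r :: real
  assumes "1 / 2 < \<beta>" "\<beta> \<le> 1" "0 < r" "r < detection_boundary \<beta>"
  obtains p where "1 < p" "p \<le> 2" "1 - \<beta> * p + r * (p\<^sup>2 - p) < 0"
proof (cases "r < \<beta> - 1 / 2")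
  case True
  then have "1 - \<beta> * 2 + r * (2\<^sup>2 - 2) < 0" by simp
  then show ?thesis by (intro that[of 2]) simp_all
next
  case False
  define s where "s = sqrt (1 - \<beta>)"
  have s: "0 \<le> s" "s\<^sup>2 = 1 - \<beta>" using assms by (auto simp: s_def)
  \<comment> \<open>For \<open>\<beta> < 3 / 4\<close> the boundary is
    \<open>\<beta> - 1 / 2\<close>, which the present case rules out.\<close>
  have \<beta>: "3 / 4 \<le> \<beta>" and r: "r < (1 - s)\<^sup>2"
    using assms False by (auto simp: detection_boundary_def s_def split: if_splits)
  have s1: "s \<le> 1 / 2"
    using s(2) \<beta> by (intro power2_le_imp_le[of s "1 / 2"]) (simp_all add: power_divide)
  have "sqrt r < 1 - s"
    using r s1 by (intro real_less_lsqrt) simp_all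
  \<comment> \<open>Rearranged to \<open>s < 1 - sqrt r\<close>, squaring replaces
    \<open>s\<^sup>2\<close> by \<open>1 - \<beta>\<close> and leads to the discriminant
    condition.\<close>
  then have "s\<^sup>2 < (1 - sqrt r)\<^sup>2"
    using s by (intro power_strict_mono) auto
  then have "2 * sqrt r < \<beta> + r"
    using assms(3) s(2) by (simp add: power2_diff)
  then have "(2 * sqrt r)\<^sup>2 < (\<beta> + r)\<^sup>2"
    using assms by (intro power_strict_mono) auto
  then have disc: "4 * r < (\<beta> + r)\<^sup>2"
    using assms by (simp add: power_mult_distrib)
  have "(1 - s)\<^sup>2 \<le> (1 - s) * (1 + s)"
    using s s1 unfolding power2_eq_square by (intro mult_left_mono) auto
  also have "\<dots> = \<beta>" using s(2) by (simp add: power2_eq_square algebra_simps)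
  finally have "r < \<beta>" using r by linarith
  have "\<beta> \<le> 3 * r" using False \<beta> by simp
  \<comment> \<open>The vertex. It exceeds \<open>1\<close> by \<open>r < \<beta>\<close> and is at
    most \<open>2\<close> by \<open>\<beta> \<le> 3 * r\<close>.\<close>
  define p where "p = (\<beta> + r) / (2 * r)"
  have rp: "r * p = (\<beta> + r) / 2" using assms by (simp add: p_def)
  have "1 - \<beta> * p + r * (p\<^sup>2 - p) = 1 - p * (\<beta> + r) + p * (r * p)"
    by (simp add: power2_eq_square algebra_simps)
  also have "\<dots> = 1 - p * (\<beta> + r) / 2" unfolding rp by simp
  also have "\<dots> = 1 - (\<beta> + r)\<^sup>2 / (4 * r)" by (simp add: p_def power2_eq_square)
  also have "\<dots> < 0" using disc assms by simp
  finally have neg: "1 - \<beta> * p + r * (p\<^sup>2 - p) < 0" .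
  have "1 < p" "p \<le> 2"
    using \<open>r < \<beta>\<close> \<open>\<beta> \<le> 3 * r\<close> assms(3) by (simp_all add: p_def pos_divide_le_eq pos_less_divide_eq)
  then show ?thesis using neg by (rule that)
qed

section \<open>Test martingales and the limit\<close>

text \<open>Conditioning on time \<open>1\<close>, where the martingale equals one almost surely,
  fixes the mean at all later times.\<close>

lemma test_martingale_integral:
  assumes "test_martingale K E" "1 \<le> t"
  shows "integrable (null_law K) (E t)" "(\<integral>x. E t x \<partial>null_law K) = 1"
proof -
  interpret prob_space "null_law K" by (rule prob_space_null_law)
  interpret finite_measure_subalgebra "null_law K" "obs_filtration K 1"
    by unfold_locales (rule subalgebra_obs_filtration)
  have int: "integrable (null_law K) (E s)" if "1 \<le> s" for s
    using assms that by (auto simp: test_martingale_def)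
  then show "integrable (null_law K) (E t)" using assms by blast
  have "AE x in null_law K. real_cond_exp (null_law K) (obs_filtration K 1) (E t) x = E 1 x"
    and "AE x in null_law K. E 1 x = 1"
    using assms by (auto simp: test_martingale_def)
  then have ae: "AE x in null_law K. real_cond_exp (null_law K) (obs_filtration K 1) (E t) x = 1"
    by eventually_elim simp
  have "(\<integral>x. E t x \<partial>null_law K) = (\<integral>x. real_cond_exp (null_law K) (obs_filtration K 1) (E t) x \<partial>null_law K)"
    using int assms by (intro real_cond_exp_int(2)[symmetric]) auto
  also have "\<dots> = (\<integral>x. 1 \<partial>null_law K)"
    using ae by (intro integral_cong_AE) auto
  finally show "(\<integral>x. E t x \<partial>null_law K) = 1" by (simp add: prob_space)
qed

lemma expected_log_const: "expected_log \<beta> T K (\<lambda>_ _. 1) t = 0"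
  by (simp add: expected_log_def ext_expectation_def ext_ln_def zero_ereal_def[symmetric])

text \<open>With the calibrated parameters \<open>\<epsilon> powr p\<close> is
  \<open>K powr (- \<beta> * p)\<close> and \<open>t * \<delta>\<^sup>2 / 2\<close> is
  \<open>t / T * ln K\<close>, so both error terms are powers of \<open>K\<close>;
  \<open>(1 + y) ^ K \<le> exp (K * y)\<close> collects the streams.\<close>

lemma expected_log_le:
  assumes "test_martingale K E" "1 \<le> t" "1 \<le> K" "0 \<le> \<beta>" "0 < T" "1 < p" "p \<le> 2"
  shows "expected_log \<beta> T K E t \<le>
    ereal ((exp (4 * (real K powr (1 - \<beta> * p) + real K powr (1 - \<beta> * p + real t / T * (p\<^sup>2 - p)))) - 1) / (p - 1))"
proof -
  define \<epsilon> where "\<epsilon> = real K powr (- \<beta>)"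
  define \<delta> where "\<delta> = sqrt (2 * (1 / T) * ln (real K))"
  have \<epsilon>: "0 \<le> \<epsilon>" "\<epsilon> \<le> 1"
    using assms powr_mono[of "- \<beta>" 0 "real K"] by (auto simp: \<epsilon>_def)
  \<comment> \<open>The excess over one in the moment bound of a single stream.\<close>
  define y where "y = 4 * \<epsilon> powr p * (1 + exp (real t * \<delta>\<^sup>2 / 2 * (p\<^sup>2 - p)))"
  have \<delta>: "\<delta>\<^sup>2 = 2 * (1 / T) * ln (real K)"
    using assms by (simp add: \<delta>_def)
  have e: "exp (real t * \<delta>\<^sup>2 / 2 * (p\<^sup>2 - p)) = real K powr (real t / T * (p\<^sup>2 - p))"
    unfolding \<delta> using assms by (simp add: powr_def mult_ac)
  have "real K * y = 4 * (real K powr 1 * real K powr (- \<beta> * p) * (1 + real K powr (real t / T * (p\<^sup>2 - p))))"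
    unfolding y_def e using assms by (simp add: \<epsilon>_def powr_powr)
  also have "\<dots> = 4 * (real K powr (1 - \<beta> * p) + real K powr (1 - \<beta> * p + real t / T * (p\<^sup>2 - p)))"
  proof -
    have "1 - \<beta> * p = 1 + - \<beta> * p" by simp
    then show ?thesis by (simp only: powr_add distrib_left mult_1_right)
  qed
  finally have Ky: "real K * y = \<dots>" .
  have y: "0 \<le> y" by (simp add: y_def)
  have "(1 + y) ^ K \<le> exp y ^ K"
    using y by (intro power_mono exp_ge_add_one_self) auto
  also have "\<dots> = exp (real K * y)" by (simp add: exp_of_nat_mult)
  finally have le: "(1 + y) ^ K \<le> exp (real K * y)" .
  have alt: "alt_law \<beta> T K = array_law K \<epsilon> \<delta>" by (simp add: alt_law_def \<epsilon>_def \<delta>_def)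
  have "subalgebra (array_law K \<epsilon> \<delta>) (obs_filtration K t)"
    using subalgebra_obs_filtration[of K t] sets_eq_imp_space_eq[OF sets_array_law] by (simp add: subalgebra_def)
  then have "expected_log \<beta> T K E t \<le> ereal ((exp (real K * y) - 1) / (p - 1))"
    unfolding expected_log_def alt
  proof (intro ext_expectation_ln_le[where L = "mixture_lr K \<epsilon> \<delta> t" and P = "null_law K"])
    have "(\<integral>\<^sup>+x. ennreal (mixture_lr K \<epsilon> \<delta> t x powr p) \<partial>null_law K) \<le> ennreal ((1 + y) ^ K)"
      unfolding y_def using assms \<epsilon> by (intro nn_integral_mixture_lr_powr_le) auto
    also have "\<dots> \<le> ennreal (exp (real K * y))" using le by (rule ennreal_leI)
    finally show "(\<integral>\<^sup>+x. ennreal (mixture_lr K \<epsilon> \<delta> t x powr p) \<partial>null_law K) \<le> \<dots>" .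
    show "AE x in null_law K. 0 \<le> E t x" "E t \<in> borel_measurable (obs_filtration K t)"
      using assms by (auto simp: test_martingale_def)
  qed (use assms \<epsilon> test_martingale_integral[OF assms(1,2)] in
      \<open>auto simp: prob_space_array_law subalgebra_obs_filtration mixture_lr_measurable_obs
        mixture_lr_nonneg nn_integral_array_law\<close>)
  then show ?thesis by (simp add: Ky)
qed

text \<open>The expected logarithm of an individual test martingale may be negative or even
  \<open>-\<infinity>\<close>, so in general it is bounded from above only. It converges to zero
  when it is asymptotically nonnegative, and so does the supremum over all test martingales, which
  is the best achievable value.\<close>

theorem corollary2p2:
  fixes t :: nat and \<beta> T :: real
    and E :: "nat \<Rightarrow> nat \<Rightarrow> (nat \<times> nat \<Rightarrow> real) \<Rightarrow> real"
  assumes "t \<ge> 1" and "1 / 2 < \<beta>" and "\<beta> \<le> 1" and "0 < T"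
    and "\<And>K. K \<ge> 1 \<Longrightarrow> test_martingale K (E K)"
    and "real t < T * detection_boundary \<beta>"
  shows "limsup (\<lambda>K. expected_log \<beta> T K (E K) t) \<le> 0 \<and>
    (0 \<le> liminf (\<lambda>K. expected_log \<beta> T K (E K) t) \<longrightarrow>
      (\<lambda>K. expected_log \<beta> T K (E K) t) \<longlonglongrightarrow> 0) \<and>
    (\<lambda>K. SUP F\<in>{F. test_martingale K F}. expected_log \<beta> T K F t) \<longlonglongrightarrow> 0"
proof -
  define r where "r = real t / T"
  have r: "0 < r" "r < detection_boundary \<beta>"
    using assms by (auto simp: r_def field_simps)
  obtain p where p: "1 < p" "p \<le> 2" and neg: "1 - \<beta> * p + r * (p\<^sup>2 - p) < 0"
    using exists_negative_exponent[OF assms(2,3) r] .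
  \<comment> \<open>Hence the exponent \<open>1 - \<beta> * p\<close> is negative as well, and both
    powers of \<open>K\<close> in the bound vanish.\<close>
  have "0 \<le> r * (p\<^sup>2 - p)"
    using r p by (simp add: power2_eq_square)
  then have neg': "1 - \<beta> * p < 0" using neg by linarith
  define b where "b K = (exp (4 * (real K powr (1 - \<beta> * p) + real K powr (1 - \<beta> * p + r * (p\<^sup>2 - p)))) - 1) / (p - 1)" for K :: nat
  have "b \<longlonglongrightarrow> (exp (4 * (0 + 0)) - 1) / (p - 1)"
    unfolding b_def using p
    by (intro tendsto_intros tendsto_neg_powr neg neg' filterlim_real_sequentially) auto
  then have b: "(\<lambda>K. ereal (b K)) \<longlonglongrightarrow> 0"
    by (simp add: zero_ereal_def)
  have le: "expected_log \<beta> T K F t \<le> ereal (b K)" if "1 \<le> K" "test_martingale K F" for K F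
    unfolding b_def r_def using that assms p by (intro expected_log_le) auto
  \<comment> \<open>The constant test martingale gives the lower bound \<open>0\<close>; the upper
    bound \<open>b\<close> is uniform in the test martingale.\<close>
  have sup: "(\<lambda>K. SUP F\<in>{F. test_martingale K F}. expected_log \<beta> T K F t) \<longlonglongrightarrow> 0"
  proof (rule tendsto_sandwich[OF _ _ tendsto_const b])
    show "\<forall>\<^sub>F K in sequentially. 0 \<le> (SUP F\<in>{F. test_martingale K F}. expected_log \<beta> T K F t)"
      using test_martingale_const
      by (intro always_eventually allI SUP_upper2[of "\<lambda>_ _. 1"]) (auto simp: expected_log_const)
    show "\<forall>\<^sub>F K in sequentially. (SUP F\<in>{F. test_martingale K F}. expected_log \<beta> T K F t) \<le> ereal (b K)"
      using eventually_ge_at_top[of 1] by eventually_elim (auto intro!: SUP_least le)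
  qed
  have "limsup (\<lambda>K. expected_log \<beta> T K (E K) t) \<le> limsup (\<lambda>K. ereal (b K))"
    by (intro Limsup_mono eventually_mono[OF eventually_ge_at_top[of 1]] le assms(5))
  also have "\<dots> = 0" using b by (intro lim_imp_Limsup) auto
  finally have ls: "limsup (\<lambda>K. expected_log \<beta> T K (E K) t) \<le> 0" .
  moreover have "(\<lambda>K. expected_log \<beta> T K (E K) t) \<longlonglongrightarrow> 0"
    if "0 \<le> liminf (\<lambda>K. expected_log \<beta> T K (E K) t)"
    using that ls Liminf_le_Limsup[of sequentially "\<lambda>K. expected_log \<beta> T K (E K) t"]
    by (intro Liminf_eq_Limsup) (auto intro: antisym order_trans)
  ultimately show ?thesis using sup by blast
qed

end
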